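(* Let $P=(\varphi_n)_{n=0}^\infty$ be a fixed sequence of functions as in the context. Let $x_0=\inf\Delta^{P^-}_{c_1\ldots c_k}$ for some $P^-$-cylinder $\Delta^{P^-}_{c_1\ldots c_k}$ of rank $k\geq 1$, where $k$ is even, and let $(x_n)_{n=1}^\infty$ be a sequence of numbers from $(0,1)\setminus IS^{P^-}$ such that $x_0<x_n<1$ for all $n\in\mathbb{N}$. Then $\lim_{n\to\infty}x_n=x_0$ if and only if there exists a number $n_0$ such that $$\begin{cases} q_i(x_n)=c_i \text{ for all } i\leq k \text{ and all } n\geq n_0,\\ \lim_{n\to\infty}q_{k+1}(x_n)=\infty.\end{cases}$$
   Context: $\mathbb{N}=\{1,2,3,\ldots\}$. Fix a sequence $P=(\varphi_n)_{n=0}^\infty$, where $\varphi_0\in\mathbb{N}$ is a constant and, for $n\ge 1$, $\varphi_n\colon\mathbb{N}^n\to\mathbb{N}$ is an arbitrary function. The $P^-$-representation (alternating Perron expansion) of $x\in(0,1]$ is an expansion $$x=\sum_{n=0}^{\infty}\frac{(-1)^n r_0 r_1\cdots r_n}{(q_1-1)q_1\cdots(q_n-1)q_n\,(q_{n+1}-1)},$$ where $q_1,q_2,\ldots\in\mathbb{N}$, $r_0=\varphi_0$, $r_n=\varphi_n(q_1,\ldots,q_n)$ and $q_n\ge r_{n-1}+1$ for all $n\in\mathbb{N}$ (the $n=0$ term is $r_0/(q_1-1)$). $IS^{P^-}\subset(0,1]$ denotes the set of numbers in $(0,1]$ that have no $P^-$-representation; it is known to be countably infinite. It is known that every $x\in(0,1)\setminus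 IS^{P^-}$ has a unique $P^-$-representation; the number $q_n=q_n(x)$ is called the $n$th $P^-$-digit of $x$. For $k\ge 1$, the $P^-$-cylinder of rank $k$ with base $c_1\ldots c_k$ is the set $\Delta^{P^-}_{c_1\ldots c_k}$ of all $x\in(0,1)\setminus IS^{P^-}$ with $q_1(x)=c_1,\ldots,q_k(x)=c_k$; here the base is admissible, i.e. $c_1\ge\varphi_0+1$ and $c_i\ge\varphi_{i-1}(c_1,\ldots,c_{i-1})+1$ for $2\le i\le k$, so that the cylinder is nonempty. It is known that each $P^-$-cylinder has the form $(a,b)\setminus IS^{P^-}$, and that $IS^{P^-}$ is exactly the set of infima and suprema of all $P^-$-cylinders. *)

theory Defs
  imports Complex_Main
begin

text \<open>
  A tuple of n positive integers is a list of length n with positive entries, so the n-th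
  function of the sequence is \<open>\<phi> n\<close>, restricted to such lists; its values on other lists are
  never used. The constant \<open>\<phi>\<^sub>0\<close> is \<open>\<phi> 0 []\<close>.
\<close>

definition perron_seq :: "(nat \<Rightarrow> nat list \<Rightarrow> nat) \<Rightarrow> bool" where
  "perron_seq \<phi> \<longleftrightarrow>
     (\<forall>n qs. length qs = n \<longrightarrow> (\<forall>q\<in>set qs. q \<ge> 1) \<longrightarrow> \<phi> n qs \<ge> 1)"

text \<open>
  Digit sequences and bases are functions on \<^typ>\<open>nat\<close> indexed from 1; the value at 0 is
  irrelevant. Below, \<open>perron_r \<phi> q n\<close> is \<open>\<phi>\<^sub>n (q\<^sub>1, ..., q\<^sub>n)\<close>.
\<close>

definition perron_r :: "(nat \<Rightarrow> nat list \<Rightarrow> nat) \<Rightarrow> (nat \<Rightarrow> nat) \<Rightarrow> nat \<Rightarrow> nat" where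
  "perron_r \<phi> q n = \<phi> n (map q [1..<Suc n])"

definition perron_term :: "(nat \<Rightarrow> nat list \<Rightarrow> nat) \<Rightarrow> (nat \<Rightarrow> nat) \<Rightarrow> nat \<Rightarrow> real" where
  "perron_term \<phi> q n =
     (-1) ^ n * (\<Prod>i=0..n. real (perron_r \<phi> q i)) /
     ((\<Prod>i=1..n. (real (q i) - 1) * real (q i)) * (real (q (n + 1)) - 1))"

definition perron_rep :: "(nat \<Rightarrow> nat list \<Rightarrow> nat) \<Rightarrow> (nat \<Rightarrow> nat) \<Rightarrow> real \<Rightarrow> bool" where
  "perron_rep \<phi> q x \<longleftrightarrow>
     (\<forall>n\<ge>1. q n \<ge> perron_r \<phi> q (n - 1) + 1) \<and> perron_term \<phi> q sums x"

definition perron_IS :: "(nat \<Rightarrow> nat list \<Rightarrow> nat) \<Rightarrow> real set" where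
  "perron_IS \<phi> = {x \<in> {0<..1}. \<nexists>q. perron_rep \<phi> q x}"

text \<open>
  Uniqueness of the representation makes the following well defined for \<open>n \<ge> 1\<close> and
  \<open>x \<in> {0<..<1} - perron_IS \<phi>\<close>; for other arguments the value carries no meaning.
\<close>

definition perron_digit :: "(nat \<Rightarrow> nat list \<Rightarrow> nat) \<Rightarrow> nat \<Rightarrow> real \<Rightarrow> nat" where
  "perron_digit \<phi> n x = (THE d. \<exists>q. perron_rep \<phi> q x \<and> q n = d)"

definition admissible_base ::
    "(nat \<Rightarrow> nat list \<Rightarrow> nat) \<Rightarrow> nat \<Rightarrow> (nat \<Rightarrow> nat) \<Rightarrow> bool" where
  "admissible_base \<phi> k c \<longleftrightarrow> (\<forall>i\<in>{1..k}. c i \<ge> perron_r \<phi> c (i - 1) + 1)"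

definition perron_cylinder ::
    "(nat \<Rightarrow> nat list \<Rightarrow> nat) \<Rightarrow> nat \<Rightarrow> (nat \<Rightarrow> nat) \<Rightarrow> real set" where
  "perron_cylinder \<phi> k c =
     {x \<in> {0<..<1} - perron_IS \<phi>. \<forall>i\<in>{1..k}. perron_digit \<phi> i x = c i}"

end

theory Submission
  imports Defs
begin

text \<open>
  Cutting the expansion of \<open>x\<close> after \<open>n\<close> terms leaves \<open>x = S\<^sub>n + (-1)\<^sup>n M\<^sub>n y\<close>, where the partial
  sum \<open>S\<^sub>n\<close> and the factor \<open>M\<^sub>n > 0\<close> depend only on the first \<open>n\<close> digits and the tail \<open>y\<close> is itself
  the value of an expansion that starts with the digit \<open>q\<^sub>n\<^sub>+\<^sub>1\<close>. Every such tail lies in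
  \<open>(0,1)\<close>, and then \<open>y = r\<^sub>n / (q\<^sub>n\<^sub>+\<^sub>1 - 1) \<cdot> (1 - y' / q\<^sub>n\<^sub>+\<^sub>1)\<close> with the next tail \<open>y'\<close> in \<open>(0,1)\<close> forces
  \<open>r\<^sub>n / q\<^sub>n\<^sub>+\<^sub>1 < y < r\<^sub>n / (q\<^sub>n\<^sub>+\<^sub>1 - 1)\<close>. For different digits these intervals are disjoint, so
  the digits can be read off from \<open>x\<close> one after another. Two facts follow.

  First, among the numbers that have an expansion, those whose digits start with \<open>c\<^sub>1 \<dots> c\<^sub>k\<close> are
  exactly those in the open interval with end points \<open>S\<^sub>k\<close> and \<open>S\<^sub>k + (-1)\<^sup>k M\<^sub>k\<close>
  (\<open>perron_cylinder_iff\<close>). Second, inside that cylinder the tail \<open>y\<close> is small exactly when the digit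
  of rank \<open>k + 1\<close> is large (\<open>tail_bounds_next_digit\<close>).

  For even \<open>k\<close> the sign is positive, so \<open>S\<^sub>k\<close> is the left end point. It is the infimum, because a
  base may be prolonged by an arbitrarily large digit (\<open>Inf_perron_cylinder_even\<close>). A sequence that
  tends to \<open>S\<^sub>k\<close> from the right is eventually inside the cylinder with tails tending to 0, which
  means that its digits of rank \<open>k + 1\<close> tend to infinity, and conversely.
\<close>

section \<open>Admissible digits and prefix dependence\<close>

definition perron_scale :: "(nat \<Rightarrow> nat list \<Rightarrow> nat) \<Rightarrow> (nat \<Rightarrow> nat) \<Rightarrow> nat \<Rightarrow> real" where
  "perron_scale \<phi> q n =
     (\<Prod>i=1..n. real (perron_r \<phi> q (i - 1)) / ((real (q i) - 1) * real (q i)))"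

text \<open>
  The number whose first \<open>n\<close> digits are those of \<open>q\<close> and whose tail is \<open>y\<close>. As a function of \<open>y\<close>
  on \<open>(0,1)\<close> it is an affine parametrisation of the interval spanned by a cylinder of rank \<open>n\<close>.
\<close>

definition perron_point ::
    "(nat \<Rightarrow> nat list \<Rightarrow> nat) \<Rightarrow> (nat \<Rightarrow> nat) \<Rightarrow> nat \<Rightarrow> real \<Rightarrow> real" where
  "perron_point \<phi> q n y = (\<Sum>i<n. perron_term \<phi> q i) + (-1) ^ n * perron_scale \<phi> q n * y"

lemma perron_r_cong:
  assumes "\<And>i. i \<in> {1..n} \<Longrightarrow> p i = q i"
  shows "perron_r \<phi> p n = perron_r \<phi> q n"
proof -
  have "map p [1..<Suc n] = map q [1..<Suc n]"
    using assms by (intro map_cong) auto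
  then show ?thesis by (simp only: perron_r_def)
qed

lemma perron_term_cong:
  assumes "\<And>i. i \<in> {1..Suc n} \<Longrightarrow> p i = q i"
  shows "perron_term \<phi> p n = perron_term \<phi> q n"
proof -
  have "(\<Prod>i=0..n. real (perron_r \<phi> p i)) = (\<Prod>i=0..n. real (perron_r \<phi> q i))"
    using assms by (intro prod.cong refl arg_cong[where f = real] perron_r_cong) auto
  moreover have "(\<Prod>i=1..n. (real (p i) - 1) * real (p i)) = (\<Prod>i=1..n. (real (q i) - 1) * real (q i))"
    using assms by (intro prod.cong) auto
  moreover have "p (n + 1) = q (n + 1)" using assms by auto
  ultimately show ?thesis by (simp only: perron_term_def)
qed

lemma perron_point_cong:
  assumes "\<And>i. i \<in> {1..n} \<Longrightarrow> p i = q i"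
  shows "perron_point \<phi> p n y = perron_point \<phi> q n y"
proof -
  have "perron_scale \<phi> p n = perron_scale \<phi> q n"
    unfolding perron_scale_def
  proof (intro prod.cong refl)
    fix i assume i: "i \<in> {1..n}"
    then have "perron_r \<phi> p (i - 1) = perron_r \<phi> q (i - 1)"
      using assms by (intro perron_r_cong) auto
    then show "real (perron_r \<phi> p (i - 1)) / ((real (p i) - 1) * real (p i)) =
        real (perron_r \<phi> q (i - 1)) / ((real (q i) - 1) * real (q i))"
      using assms[OF i] by simp
  qed
  moreover have "(\<Sum>i<n. perron_term \<phi> p i) = (\<Sum>i<n. perron_term \<phi> q i)"
    using assms by (intro sum.cong refl perron_term_cong) auto
  ultimately show ?thesis by (simp add: perron_point_def)
qed

lemma admissible_base_mono: "admissible_base \<phi> k c \<Longrightarrow> j \<le> k \<Longrightarrow> admissible_base \<phi> j c"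
  by (auto simp: admissible_base_def)

lemma admissible_base_cong:
  assumes "\<And>i. i \<in> {1..k} \<Longrightarrow> p i = q i"
  shows "admissible_base \<phi> k p \<longleftrightarrow> admissible_base \<phi> k q"
proof -
  have "perron_r \<phi> p (i - 1) = perron_r \<phi> q (i - 1)" if "i \<in> {1..k}" for i
    using assms that by (intro perron_r_cong) auto
  then show ?thesis using assms by (simp add: admissible_base_def)
qed

lemma perron_rep_iff:
  "perron_rep \<phi> q x \<longleftrightarrow> (\<forall>k. admissible_base \<phi> k q) \<and> perron_term \<phi> q sums x"
  unfolding perron_rep_def admissible_base_def
  by (metis atLeastAtMost_iff order_refl)

lemma perron_r_ge_1:
  assumes "perron_seq \<phi>" and "admissible_base \<phi> n c"
  shows "perron_r \<phi> c n \<ge> 1"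
proof -
  have "c i \<ge> 1" if "i \<in> {1..n}" for i
    using assms(2) that unfolding admissible_base_def by (meson add_leD2)
  then have "\<forall>d\<in>set (map c [1..<Suc n]). d \<ge> 1" by auto
  moreover have "length (map c [1..<Suc n]) = n" by simp
  ultimately show ?thesis
    using assms(1) unfolding perron_seq_def perron_r_def by blast
qed

lemma admissible_digit:
  assumes "perron_seq \<phi>" and "admissible_base \<phi> (Suc n) c"
  shows "c (Suc n) \<ge> perron_r \<phi> c n + 1" and "c (Suc n) \<ge> 2"
proof -
  show *: "c (Suc n) \<ge> perron_r \<phi> c n + 1"
    using assms(2) by (force simp: admissible_base_def)
  have "perron_r \<phi> c n \<ge> 1"
    using assms by (blast intro: perron_r_ge_1 admissible_base_mono le_SucI)
  with * show "c (Suc n) \<ge> 2" by linarith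
qed

lemma perron_scale_pos:
  assumes "perron_seq \<phi>" and "admissible_base \<phi> n c"
  shows "perron_scale \<phi> c n > 0"
  unfolding perron_scale_def
proof (intro prod_pos ballI)
  fix i assume i: "i \<in> {1..n}"
  then obtain j where j: "i = Suc j" "j < n" by (cases i) auto
  have "admissible_base \<phi> (Suc j) c" "admissible_base \<phi> j c"
    using assms(2) j by (auto intro: admissible_base_mono)
  then have "c i \<ge> 2" "perron_r \<phi> c (i - 1) \<ge> 1"
    using admissible_digit(2) perron_r_ge_1 assms(1) j by auto
  then show "0 < real (perron_r \<phi> c (i - 1)) / ((real (c i) - 1) * real (c i))"
    by (intro divide_pos_pos mult_pos_pos) auto
qed

section \<open>Tails of an expansion\<close>

lemma perron_term_eq:
  "perron_term \<phi> q n =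
     (-1) ^ n * (perron_scale \<phi> q n * (real (perron_r \<phi> q n) / (real (q (Suc n)) - 1)))"
proof -
  have "(\<Prod>i=0..n. real (perron_r \<phi> q i)) =
      (\<Prod>i=1..n. real (perron_r \<phi> q (i - 1))) * real (perron_r \<phi> q n)"
    by (induction n) simp_all
  then show ?thesis
    by (simp add: perron_term_def perron_scale_def prod_dividef)
qed

lemma perron_scale_Suc:
  "perron_scale \<phi> q (Suc n) = perron_scale \<phi> q n *
     (real (perron_r \<phi> q n) / ((real (q (Suc n)) - 1) * real (q (Suc n))))"
  by (simp add: perron_scale_def)

text \<open>
  This recursion localises a tail by means of its first digit, and, read from left to right, it
  shows that the interval of a base lies inside the interval of each of its prefixes.
\<close>

lemma perron_point_Suc:
  assumes "q (Suc n) \<noteq> 0"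
  shows "perron_point \<phi> q (Suc n) y =
    perron_point \<phi> q n (real (perron_r \<phi> q n) / (real (q (Suc n)) - 1) * (1 - y / real (q (Suc n))))"
  using assms
  by (simp add: perron_point_def perron_term_eq perron_scale_Suc right_diff_distrib)

text \<open>
  The tail determines the interval \<open>(r / d, r / (d - 1))\<close> of its first digit \<open>d\<close>; the condition
  \<open>d \<ge> r + 1\<close> keeps that interval inside \<open>(0,1)\<close>.
\<close>

lemma tail_step_bounds:
  fixes r d :: nat and y :: real
  assumes "r \<ge> 1" and "d \<ge> r + 1" and "0 < y" and "y < 1"
  defines "z \<equiv> real r / (real d - 1) * (1 - y / real d)"
  shows "real r / real d < z" and "z < real r / (real d - 1)" and "0 < z" and "z < 1"
proof -
  have d: "real d \<ge> real r + 1" "real r \<ge> 1" using assms by linarith+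
  have "real r / real d = real r / (real d - 1) * (1 - 1 / real d)"
    using d by (simp add: field_simps)
  also have "\<dots> < z"
    unfolding z_def using d assms(3,4)
    by (intro mult_strict_left_mono) (auto simp: divide_strict_right_mono)
  finally show 1: "real r / real d < z" .
  show 2: "z < real r / (real d - 1)"
  proof -
    have "z < real r / (real d - 1) * 1"
      unfolding z_def using d assms(3) by (intro mult_strict_left_mono) auto
    then show ?thesis by simp
  qed
  show "0 < z" using 1 d by (meson divide_nonneg_nonneg le_less_trans of_nat_0_le_iff)
  have "real r / (real d - 1) \<le> 1" using d by simp
  with 2 show "z < 1" by linarith
qed

lemma digit_interval_unique:
  fixes r d e :: nat and z :: real
  assumes "z > 0" and "d \<ge> 2" and "e \<ge> 2"
    and "real r / real d < z" and "z < real r / (real d - 1)"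
    and "real r / real e < z" and "z < real r / (real e - 1)"
  shows "d = e"
proof -
  \<comment> \<open>Both \<open>d\<close> and \<open>e\<close> are the least integer above \<open>r / z\<close>.\<close>
  have "real r / z < real d" "real d - 1 < real r / z" "real r / z < real e" "real e - 1 < real r / z"
    using assms by (simp_all add: field_simps)
  then show ?thesis by linarith
qed

text \<open>
  Consecutive terms shrink by the factor \<open>r\<^sub>n\<^sub>+\<^sub>1 / (q\<^sub>n\<^sub>+\<^sub>1 (q\<^sub>n\<^sub>+\<^sub>2 - 1)) \<le> 1 / q\<^sub>n\<^sub>+\<^sub>1 \<le> 1 / 2\<close>, so an
  expansion with admissible digits always converges and Leibniz' criterion applies to it.
\<close>

lemma perron_term_ratio:
  assumes "perron_seq \<phi>" and "\<And>k. admissible_base \<phi> k q"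
  shows "\<bar>perron_term \<phi> q (Suc n)\<bar> \<le> 1/2 * \<bar>perron_term \<phi> q n\<bar>"
proof -
  let ?b = "\<lambda>n. perron_scale \<phi> q n * (real (perron_r \<phi> q n) / (real (q (Suc n)) - 1))"
  note adm = admissible_digit[OF assms(1) assms(2)]
  have pos: "?b n \<ge> 0" for n
    using perron_scale_pos[OF assms(1) assms(2)] adm(2)[of n]
    by (intro mult_nonneg_nonneg divide_nonneg_nonneg) (auto simp: less_imp_le)
  have abs: "\<bar>perron_term \<phi> q n\<bar> = ?b n" for n
    unfolding perron_term_eq abs_mult[of "(-1) ^ n"] abs_of_nonneg[OF pos] by simp
  let ?d = "real (q (Suc n))" and ?t = "real (perron_r \<phi> q (Suc n)) / (real (q (Suc (Suc n))) - 1)"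
  have d: "?d \<ge> 2" using adm(2)[of n] by linarith
  have t: "0 \<le> ?t" "?t \<le> 1" using adm(1)[of "Suc n"] adm(2)[of "Suc n"] by auto
  have "?b (Suc n) = ?b n * (?t / ?d)"
    by (simp add: perron_scale_Suc)
  also have "\<dots> \<le> ?b n * (1 / 2)"
    using d t by (intro mult_left_mono pos frac_le) auto
  finally show ?thesis unfolding abs by (simp only: mult.commute)
qed

lemma perron_rep_exists:
  assumes "perron_seq \<phi>" and "\<And>k. admissible_base \<phi> k q"
  obtains x where "perron_rep \<phi> q x"
proof -
  have "summable (perron_term \<phi> q)"
    by (rule summable_ratio_test[of "1/2" 0])
      (use perron_term_ratio[OF assms] in auto)
  then show ?thesis using that assms(2) by (auto simp: perron_rep_iff summable_def)
qed

text \<open>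
  The terms alternate in sign and decrease in absolute value, so \<open>x\<close> lies above the partial sums of
  even length and below those of odd length.
\<close>

lemma perron_rep_between_partial_sums:
  assumes "perron_seq \<phi>" and "perron_rep \<phi> q x"
  shows "0 \<le> (-1) ^ n * (x - (\<Sum>i<n. perron_term \<phi> q i))"
proof -
  have adm: "\<And>k. admissible_base \<phi> k q" and sums: "perron_term \<phi> q sums x"
    using assms(2) by (auto simp: perron_rep_iff)
  define b where
    "b = (\<lambda>n. perron_scale \<phi> q n * (real (perron_r \<phi> q n) / (real (q (Suc n)) - 1)))"
  have terms: "perron_term \<phi> q = (\<lambda>n. (-1) ^ n * b n)"
    by (simp add: fun_eq_iff perron_term_eq b_def)
  have pos: "b n > 0" for n
    using perron_scale_pos[OF assms(1) adm, of n] perron_r_ge_1[OF assms(1) adm, of n]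
      admissible_digit(2)[OF assms(1) adm, of n]
    unfolding b_def by (intro mult_pos_pos divide_pos_pos) auto
  have abs: "\<bar>perron_term \<phi> q n\<bar> = b n" for n
    using pos[of n] by (simp add: terms abs_mult)
  have dec: "b (Suc n) \<le> b n" for n
    using perron_term_ratio[OF assms(1) adm, of n] pos[of n] unfolding abs by linarith
  have "perron_term \<phi> q \<longlonglongrightarrow> 0"
    using sums by (intro summable_LIMSEQ_zero) (auto simp: sums_iff)
  then have "(\<lambda>n. \<bar>perron_term \<phi> q n\<bar>) \<longlonglongrightarrow> 0" by (rule tendsto_rabs_zero)
  then have lim: "b \<longlonglongrightarrow> 0" by (simp add: abs)
  have mono: "monoseq b" using dec by (simp add: monoseq_Suc)
  have x: "(\<Sum>i. (-1) ^ i * b i) = x" using sums by (simp add: terms sums_iff)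
  have bounds: "(\<Sum>i<2*n. perron_term \<phi> q i) \<le> x" "x \<le> (\<Sum>i<2*n+1. perron_term \<phi> q i)" for n
    using summable_Leibniz(2)[OF lim mono] pos[of 0] unfolding x terms by auto
  show ?thesis
  proof (cases "even n")
    case True
    then obtain m where "n = 2 * m" by blast
    then show ?thesis using bounds(1)[of m] by simp
  next
    case False
    then obtain m where "n = 2 * m + 1" by (rule oddE)
    then show ?thesis using bounds(2)[of m] by simp
  qed
qed

text \<open>
  Tails are obtained by solving \<open>x = S\<^sub>n + (-1)\<^sup>n M\<^sub>n y\<close> for \<open>y\<close>, not as expansions for a shifted
  sequence \<open>\<phi>\<close>; everything about them follows from the position of \<open>x\<close> relative to
  consecutive partial sums.
\<close>

lemma perron_rep_tail:
  assumes "perron_seq \<phi>" and "perron_rep \<phi> q x"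
  obtains y where "0 < y" and "y < 1" and "x = perron_point \<phi> q n y"
proof -
  have adm: "\<And>k. admissible_base \<phi> k q" using assms(2) by (simp add: perron_rep_iff)
  define S where "S n = (\<Sum>i<n. perron_term \<phi> q i)" for n
  define M where "M = perron_scale \<phi> q"
  define r where "r = perron_r \<phi> q"
  define y where "y n = (-1) ^ n * (x - S n) / M n" for n
  define a where "a n = real (r n) / (real (q (Suc n)) - 1)" for n
  have M: "M n > 0" for n unfolding M_def by (rule perron_scale_pos[OF assms(1) adm])
  have rq: "r n \<ge> 1" "q (Suc n) \<ge> r n + 1" "q (Suc n) \<ge> 2" for n
    using perron_r_ge_1[OF assms(1) adm] admissible_digit[OF assms(1) adm] by (auto simp: r_def)
  have a: "0 < a n" "a n \<le> 1" for n
    using rq[of n] by (auto simp: a_def)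
  have S_Suc: "S (Suc n) = S n + (-1) ^ n * (M n * a n)" for n
    by (simp add: S_def perron_term_eq M_def a_def r_def)
  have x: "x = S n + (-1) ^ n * M n * y n" for n
    using M[of n] by (simp add: y_def)
  have nonneg: "0 \<le> y n" for n
    using perron_rep_between_partial_sums[OF assms, of n] M[of n] by (simp add: y_def S_def)
  have le: "y n \<le> a n" for n
  proof -
    have "0 \<le> (-1) ^ Suc n * (x - S (Suc n))"
      using perron_rep_between_partial_sums[OF assms, of "Suc n"] by (simp add: S_def)
    also have "\<dots> = M n * (a n - y n)"
      unfolding S_Suc x[of n] by (cases "even n") (simp_all add: algebra_simps)
    finally show ?thesis using M[of n] by (simp add: zero_le_mult_iff)
  qed
  have step: "y n = a n * (1 - y (Suc n) / real (q (Suc n)))" for n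
  proof -
    have "M (Suc n) = M n * (a n / real (q (Suc n)))"
      by (simp add: M_def perron_scale_Suc a_def r_def)
    then have "S n + (-1) ^ n * M n * y n =
        S n + (-1) ^ n * (M n * a n) - (-1) ^ n * (M n * (a n / real (q (Suc n)))) * y (Suc n)"
      using x[of n] x[of "Suc n"] by (simp add: S_Suc)
    then have "(-1) ^ n * M n * (y n - a n * (1 - y (Suc n) / real (q (Suc n)))) = 0"
      by (simp add: algebra_simps)
    then show ?thesis using M[of n] by simp
  qed
  \<comment> \<open>Leibniz gives the closed bounds \<open>0 \<le> y \<le> 1\<close> for all tails; applied to the next tail they
    make \<open>y\<close> positive, and positivity of the next tail makes \<open>y < 1\<close>.\<close>
  have pos: "0 < y n" for n
  proof -
    have "y (Suc n) \<le> 1" using le[of "Suc n"] a(2)[of "Suc n"] by linarith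
    then have "y (Suc n) / real (q (Suc n)) < 1" using rq(3)[of n] by simp
    then show ?thesis using step[of n] a(1)[of n] by simp
  qed
  have "y n < 1" for n
  proof -
    have "0 < y (Suc n) / real (q (Suc n))" using pos[of "Suc n"] rq(3)[of n] by simp
    then have "a n * (1 - y (Suc n) / real (q (Suc n))) < a n * 1"
      using a(1)[of n] by (intro mult_strict_left_mono) auto
    then show ?thesis using step[of n] a(2)[of n] by linarith
  qed
  then show ?thesis
    using that[of "y n"] pos[of n] x[of n] by (simp add: perron_point_def S_def M_def)
qed

section \<open>Digits and cylinders\<close>

lemma perron_point_inj:
  assumes "perron_seq \<phi>" and "admissible_base \<phi> n c"
    and "perron_point \<phi> c n y = perron_point \<phi> c n z"
  shows "y = z"
  using perron_scale_pos[OF assms(1,2)] assms(3) by (simp add: perron_point_def)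

text \<open>
  A number in the interval of a base has that base as its initial digits. The intervals of growing
  rank are nested, so this is an induction on the rank: once \<open>n\<close> digits agree, the tails of rank
  \<open>n\<close> coincide, and a tail determines its first digit.
\<close>

lemma digits_of_perron_point:
  assumes "perron_seq \<phi>" and "perron_rep \<phi> q x" and "admissible_base \<phi> n c"
    and "0 < y" and "y < 1" and "x = perron_point \<phi> c n y"
  shows "\<forall>i\<in>{1..n}. q i = c i"
  using assms(3-6)
proof (induction n arbitrary: y)
  case 0
  then show ?case by simp
next
  case (Suc n)
  have adm: "admissible_base \<phi> k q" for k using assms(2) by (simp add: perron_rep_iff)
  have admc: "admissible_base \<phi> n c" using Suc.prems(1) by (rule admissible_base_mono) simp
  let ?r = "perron_r \<phi> c n" and ?d = "c (Suc n)" and ?e = "q (Suc n)"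
  define z where "z = real ?r / (real ?d - 1) * (1 - y / real ?d)"
  note c = admissible_digit[OF assms(1) Suc.prems(1)]
  have r: "?r \<ge> 1" using perron_r_ge_1[OF assms(1) admc] .
  have z: "real ?r / real ?d < z" "z < real ?r / (real ?d - 1)" "0 < z" "z < 1"
    using tail_step_bounds[OF r c(1) Suc.prems(2,3)] by (simp_all add: z_def)
  have xz: "x = perron_point \<phi> c n z"
    using Suc.prems(4) c(2) by (simp add: perron_point_Suc z_def)
  have agree: "\<forall>i\<in>{1..n}. q i = c i" using Suc.IH[OF admc z(3,4) xz] .
  then have rq: "perron_r \<phi> q n = ?r" by (intro perron_r_cong) auto
  obtain w where w: "0 < w" "w < 1" "x = perron_point \<phi> q (Suc n) w"
    using perron_rep_tail[OF assms(1,2)] .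
  note q = admissible_digit[OF assms(1) adm, of n]
  define v where "v = real ?r / (real ?e - 1) * (1 - w / real ?e)"
  have v: "real ?r / real ?e < v" "v < real ?r / (real ?e - 1)"
    using tail_step_bounds[OF r _ w(1,2), of ?e] q(1) by (simp_all add: v_def rq)
  have "x = perron_point \<phi> q n v"
    using w(3) q(2) by (simp add: perron_point_Suc v_def rq)
  also have "\<dots> = perron_point \<phi> c n v" using agree by (intro perron_point_cong) auto
  finally have "v = z" using perron_point_inj[OF assms(1) admc] xz by simp
  then have "?e = ?d"
    using digit_interval_unique[of z ?e ?d ?r] z v c(2) q(2) by simp
  then show ?case using agree by (auto simp: le_Suc_eq)
qed

lemma perron_digit_eq:
  assumes "perron_seq \<phi>" and "perron_rep \<phi> q x" and "i \<ge> 1"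
  shows "perron_digit \<phi> i x = q i"
  unfolding perron_digit_def
proof (rule the_equality)
  show "\<exists>p. perron_rep \<phi> p x \<and> p i = q i" using assms(2) by blast
next
  fix d assume "\<exists>p. perron_rep \<phi> p x \<and> p i = d"
  then obtain p where p: "perron_rep \<phi> p x" "p i = d" by blast
  obtain y where "0 < y" "y < 1" "x = perron_point \<phi> q i y"
    using perron_rep_tail[OF assms(1,2)] .
  moreover have "admissible_base \<phi> i q" using assms(2) by (simp add: perron_rep_iff)
  ultimately have "\<forall>j\<in>{1..i}. p j = q j"
    by (intro digits_of_perron_point[OF assms(1) p(1)])
  then show "d = q i" using assms(3) p(2) by auto
qed

lemma perron_rep_in_unit_interval:
  assumes "perron_seq \<phi>" and "perron_rep \<phi> q x"
  shows "x \<in> {0<..<1} - perron_IS \<phi>"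
proof -
  obtain y where "0 < y" "y < 1" "x = perron_point \<phi> q 0 y"
    using perron_rep_tail[OF assms] .
  then show ?thesis
    using assms(2) by (auto simp: perron_point_def perron_scale_def perron_IS_def)
qed

lemma perron_rep_obtain:
  assumes "x \<in> {0<..<1} - perron_IS \<phi>"
  obtains q where "perron_rep \<phi> q x"
  using assms by (auto simp: perron_IS_def)

lemma perron_cylinder_iff:
  assumes "perron_seq \<phi>" and "admissible_base \<phi> k c" and "x \<in> {0<..<1} - perron_IS \<phi>"
  shows "x \<in> perron_cylinder \<phi> k c \<longleftrightarrow> (\<exists>y. 0 < y \<and> y < 1 \<and> x = perron_point \<phi> c k y)"
proof -
  obtain q where q: "perron_rep \<phi> q x" using perron_rep_obtain[OF assms(3)] .
  have "x \<in> perron_cylinder \<phi> k c \<longleftrightarrow> (\<forall>i\<in>{1..k}. q i = c i)"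
    using assms(3) perron_digit_eq[OF assms(1) q] by (auto simp: perron_cylinder_def)
  also have "\<dots> \<longleftrightarrow> (\<exists>y. 0 < y \<and> y < 1 \<and> x = perron_point \<phi> c k y)"
  proof
    assume agree: "\<forall>i\<in>{1..k}. q i = c i"
    obtain y where y: "0 < y" "y < 1" "x = perron_point \<phi> q k y"
      using perron_rep_tail[OF assms(1) q] .
    have "x = perron_point \<phi> c k y"
      unfolding y(3) using agree by (intro perron_point_cong) auto
    with y show "\<exists>y. 0 < y \<and> y < 1 \<and> x = perron_point \<phi> c k y" by blast
  next
    assume "\<exists>y. 0 < y \<and> y < 1 \<and> x = perron_point \<phi> c k y"
    then show "\<forall>i\<in>{1..k}. q i = c i"
      using digits_of_perron_point[OF assms(1) q assms(2)] by blast
  qed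
  finally show ?thesis .
qed

text \<open>
  Inside a cylinder of rank \<open>k\<close>, the tail and the digit of rank \<open>k + 1\<close> are inversely proportional
  up to a bounded error; this turns the digit condition of the theorem into a metric one.
\<close>

lemma tail_bounds_next_digit:
  assumes "perron_seq \<phi>" and "admissible_base \<phi> k c" and "x \<in> perron_cylinder \<phi> k c"
    and "x = perron_point \<phi> c k y"
  defines "r \<equiv> real (perron_r \<phi> c k)" and "d \<equiv> real (perron_digit \<phi> (k + 1) x)"
  shows "r / d < y" and "y < r / (d - 1)" and "d \<ge> 2"
proof -
  have x: "x \<in> {0<..<1} - perron_IS \<phi>"
    using assms(3) unfolding perron_cylinder_def by blast
  obtain q where q: "perron_rep \<phi> q x" using perron_rep_obtain[OF x] .
  have agree: "q i = c i" if "i \<in> {1..k}" for i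
    using assms(3) that perron_digit_eq[OF assms(1) q, of i] by (auto simp: perron_cylinder_def)
  have rq: "perron_r \<phi> q k = perron_r \<phi> c k" using agree by (rule perron_r_cong)
  have d: "d = real (q (Suc k))" using perron_digit_eq[OF assms(1) q] by (simp add: d_def)
  have adm: "admissible_base \<phi> j q" for j using q by (simp add: perron_rep_iff)
  note q1 = admissible_digit[OF assms(1) adm, of k]
  have r1: "perron_r \<phi> q k \<ge> 1" using perron_r_ge_1[OF assms(1) adm] .
  obtain w where w: "0 < w" "w < 1" "x = perron_point \<phi> q (Suc k) w"
    using perron_rep_tail[OF assms(1) q] .
  define v where "v = r / (d - 1) * (1 - w / d)"
  have "x = perron_point \<phi> q k v"
    using w(3) q1(2) by (simp add: perron_point_Suc v_def d r_def rq)
  also have "\<dots> = perron_point \<phi> c k v" using agree by (rule perron_point_cong)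
  finally have "y = v" using perron_point_inj[OF assms(1,2)] assms(4) by simp
  then show "r / d < y" and "y < r / (d - 1)"
    using tail_step_bounds(1,2)[OF r1 q1(1) w(1,2)] by (simp_all add: v_def d r_def rq)
  show "d \<ge> 2" using q1(2) by (simp add: d)
qed

section \<open>Left end points of cylinders of even rank\<close>

fun greedy_extension :: "(nat \<Rightarrow> nat list \<Rightarrow> nat) \<Rightarrow> nat \<Rightarrow> (nat \<Rightarrow> nat) \<Rightarrow> nat \<Rightarrow> nat" where
  "greedy_extension \<phi> k c n =
     (if n \<le> k then c n else \<phi> (n - 1) (map (greedy_extension \<phi> k c) [1..<n]) + 1)"

declare greedy_extension.simps [simp del]

lemma admissible_greedy_extension:
  assumes "admissible_base \<phi> k c"
  shows "admissible_base \<phi> j (greedy_extension \<phi> k c)"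
proof -
  let ?q = "greedy_extension \<phi> k c"
  have base: "admissible_base \<phi> k ?q"
    using assms by (subst admissible_base_cong[where q = c]) (auto simp: greedy_extension.simps)
  have "?q i \<ge> perron_r \<phi> ?q (i - 1) + 1" if "i \<ge> 1" for i
  proof (cases "i \<le> k")
    case True
    then show ?thesis using base that by (simp add: admissible_base_def)
  next
    case False
    then show ?thesis
      using that greedy_extension.simps[of \<phi> k c i] by (simp add: perron_r_def)
  qed
  then show ?thesis by (simp add: admissible_base_def)
qed

text \<open>
  A large digit of rank \<open>k + 1\<close> makes the tail small, so the points of a cylinder accumulate at the
  end point with parameter 0.
\<close>

lemma perron_cylinder_small_tail:
  assumes "perron_seq \<phi>" and "admissible_base \<phi> k c" and "e > 0"
  obtains y where "0 < y" and "y < e" and "perron_point \<phi> c k y \<in> perron_cylinder \<phi> k c"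
proof -
  let ?r = "perron_r \<phi> c k"
  obtain N :: nat where N: "real ?r / e < real N" using reals_Archimedean2 by blast
  define d where "d = N + ?r + 1"
  define b where "b = c(Suc k := d)"
  have agree: "b i = c i" if "i \<in> {1..k}" for i using that by (simp add: b_def)
  have "perron_r \<phi> b k = ?r" using agree by (rule perron_r_cong)
  then have "admissible_base \<phi> (Suc k) b"
    using admissible_base_cong[of k b c \<phi>, OF agree] assms(2)
    by (auto simp: admissible_base_def le_Suc_eq b_def d_def)
  then have adm: "\<And>j. admissible_base \<phi> j (greedy_extension \<phi> (Suc k) b)"
    by (rule admissible_greedy_extension)
  define q where "q = greedy_extension \<phi> (Suc k) b"
  have qb: "q i = b i" if "i \<le> Suc k" for i
    using that by (simp add: q_def greedy_extension.simps)
  obtain x where x: "perron_rep \<phi> q x"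
    using perron_rep_exists[OF assms(1)] adm unfolding q_def by blast
  have xI: "x \<in> {0<..<1} - perron_IS \<phi>" using perron_rep_in_unit_interval[OF assms(1) x] .
  have cyl: "x \<in> perron_cylinder \<phi> k c"
    using xI perron_digit_eq[OF assms(1) x] agree by (auto simp: perron_cylinder_def qb)
  then obtain y where y: "0 < y" "y < 1" "x = perron_point \<phi> c k y"
    using perron_cylinder_iff[OF assms(1,2) xI] by blast
  have "perron_digit \<phi> (k + 1) x = d"
    using perron_digit_eq[OF assms(1) x] by (simp add: qb b_def)
  then have "y < real ?r / (real d - 1)"
    using tail_bounds_next_digit(2)[OF assms(1,2) cyl y(3)] by simp
  also have "\<dots> \<le> e"
  proof -
    have "real ?r \<ge> 1" using perron_r_ge_1[OF assms(1,2)] by simp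
    moreover have "real d - 1 = real N + real ?r" by (simp add: d_def)
    moreover have "real ?r < e * real N" using N assms(3) by (simp add: field_simps)
    moreover have "0 \<le> e * real ?r" using assms(3) by simp
    ultimately show ?thesis by (simp add: divide_le_eq distrib_left)
  qed
  finally show ?thesis using that[of y] y(1,3) cyl by simp
qed

lemma Inf_perron_cylinder_even:
  assumes "perron_seq \<phi>" and "admissible_base \<phi> k c" and "even k"
  shows "Inf (perron_cylinder \<phi> k c) = perron_point \<phi> c k 0"
proof (rule cInf_eq)
  have M: "perron_scale \<phi> c k > 0" using perron_scale_pos[OF assms(1,2)] .
  have point: "perron_point \<phi> c k y = perron_point \<phi> c k 0 + perron_scale \<phi> c k * y" for y
    using assms(3) by (simp add: perron_point_def)
  show "perron_point \<phi> c k 0 \<le> x" if x: "x \<in> perron_cylinder \<phi> k c" for x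
  proof -
    have "x \<in> {0<..<1} - perron_IS \<phi>" using x unfolding perron_cylinder_def by blast
    then obtain y where "0 < y" "x = perron_point \<phi> c k y"
      using perron_cylinder_iff[OF assms(1,2)] x by blast
    then show ?thesis using M point[of y] by simp
  qed
  show "l \<le> perron_point \<phi> c k 0" if l: "\<And>x. x \<in> perron_cylinder \<phi> k c \<Longrightarrow> l \<le> x" for l
  proof (rule ccontr)
    assume "\<not> ?thesis"
    then have "(l - perron_point \<phi> c k 0) / perron_scale \<phi> c k > 0" using M by simp
    then obtain y where y: "y < (l - perron_point \<phi> c k 0) / perron_scale \<phi> c k"
        "perron_point \<phi> c k y \<in> perron_cylinder \<phi> k c"
      using perron_cylinder_small_tail[OF assms(1,2)] by blast
    have "perron_point \<phi> c k y < l" using y(1) M point[of y] by (simp add: field_simps)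
    then show False using l[OF y(2)] by simp
  qed
qed

section \<open>Convergence to a left end point\<close>

theorem proposition9:
  fixes \<phi> :: "nat \<Rightarrow> nat list \<Rightarrow> nat"
    and k :: nat and c :: "nat \<Rightarrow> nat"
    and x0 :: real and x :: "nat \<Rightarrow> real"
  assumes "perron_seq \<phi>"
    and "k \<ge> 1" and "even k"
    and "admissible_base \<phi> k c"
    and "x0 = Inf (perron_cylinder \<phi> k c)"
    and "\<And>n. n \<ge> 1 \<Longrightarrow> x n \<in> {0<..<1} - perron_IS \<phi>"
    and "\<And>n. n \<ge> 1 \<Longrightarrow> x0 < x n \<and> x n < 1"
  shows "x \<longlonglongrightarrow> x0 \<longleftrightarrow>
    (\<exists>n0\<ge>1. (\<forall>n\<ge>n0. \<forall>i\<in>{1..k}. perron_digit \<phi> i (x n) = c i) \<and>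
            filterlim (\<lambda>n. perron_digit \<phi> (k + 1) (x n)) at_top sequentially)"
proof -
  let ?cyl = "perron_cylinder \<phi> k c" and ?d = "\<lambda>n. perron_digit \<phi> (k + 1) (x n)"
  define M where "M = perron_scale \<phi> c k"
  define r where "r = real (perron_r \<phi> c k)"
  define y where "y n = (x n - x0) / M" for n
  have M: "M > 0" using perron_scale_pos[OF assms(1,4)] by (simp add: M_def)
  have r: "r \<ge> 1" using perron_r_ge_1[OF assms(1,4)] by (simp add: r_def)
  have point: "perron_point \<phi> c k z = x0 + M * z" for z
    using Inf_perron_cylinder_even[OF assms(1,4,3)] assms(3,5)
    by (simp add: perron_point_def M_def)
  have xy: "x n = perron_point \<phi> c k (y n)" for n
    using M by (simp add: point y_def)
  have y_pos: "0 < y n" if "n \<ge> 1" for n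
    using assms(7)[OF that] M by (simp add: y_def)
  have cyl_iff: "x n \<in> ?cyl \<longleftrightarrow> (\<forall>i\<in>{1..k}. perron_digit \<phi> i (x n) = c i)" if "n \<ge> 1" for n
    using assms(6)[OF that] by (auto simp: perron_cylinder_def)
  have bounds: "r / real (?d n) < y n" "y n < r / (real (?d n) - 1)" "real (?d n) \<ge> 2"
    if "x n \<in> ?cyl" for n
    using tail_bounds_next_digit[OF assms(1,4) that xy] by (simp_all add: r_def)
  have lim_iff: "x \<longlonglongrightarrow> x0 \<longleftrightarrow> y \<longlonglongrightarrow> 0"
  proof
    assume "x \<longlonglongrightarrow> x0"
    then have "(\<lambda>n. (x n - x0) / M) \<longlonglongrightarrow> (x0 - x0) / M" using M by (intro tendsto_intros) auto
    then show "y \<longlonglongrightarrow> 0" by (simp add: y_def[abs_def])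
  next
    assume "y \<longlonglongrightarrow> 0"
    then have "(\<lambda>n. x0 + M * y n) \<longlonglongrightarrow> x0 + M * 0" by (intro tendsto_intros)
    then show "x \<longlonglongrightarrow> x0" by (simp add: xy[unfolded point, symmetric])
  qed
  show ?thesis
  proof
    assume "x \<longlonglongrightarrow> x0"
    then have y0: "y \<longlonglongrightarrow> 0" by (simp add: lim_iff)
    then have "eventually (\<lambda>n. y n < 1) sequentially" by (rule order_tendstoD) simp
    then obtain n1 where n1: "\<And>n. n \<ge> n1 \<Longrightarrow> y n < 1" by (auto simp: eventually_sequentially)
    \<comment> \<open>The hypotheses constrain the sequence from index 1 on only, hence the maximum with 1.\<close>
    have cyl: "x n \<in> ?cyl" if "n \<ge> max 1 n1" for n
    proof -
      have "n \<ge> 1" "y n < 1" using that n1 by auto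
      then show ?thesis
        using perron_cylinder_iff[OF assms(1,4) assms(6)] y_pos xy by blast
    qed
    have "filterlim ?d at_top sequentially"
      unfolding filterlim_at_top
    proof
      fix Z :: nat
      have "eventually (\<lambda>n. y n < r / (real Z + 1)) sequentially"
        using y0 r by (intro order_tendstoD(2)) auto
      then show "eventually (\<lambda>n. Z \<le> ?d n) sequentially"
        using eventually_ge_at_top[of "max 1 n1"]
      proof eventually_elim
        case (elim n)
        note b = bounds[OF cyl[OF elim(2)]]
        have "r / real (?d n) < r / (real Z + 1)" using b(1) elim(1) by linarith
        then have "r * (real Z + 1) < r * real (?d n)"
          using b(3) by (simp add: field_simps)
        then have "real Z + 1 < real (?d n)" using r by simp
        then show ?case by linarith
      qed
    qed
    moreover have "\<forall>n\<ge>max 1 n1. \<forall>i\<in>{1..k}. perron_digit \<phi> i (x n) = c i"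
      using cyl cyl_iff by auto
    ultimately show "\<exists>n0\<ge>1. (\<forall>n\<ge>n0. \<forall>i\<in>{1..k}. perron_digit \<phi> i (x n) = c i) \<and>
        filterlim ?d at_top sequentially"
      by (intro exI[of _ "max 1 n1"]) auto
  next
    assume "\<exists>n0\<ge>1. (\<forall>n\<ge>n0. \<forall>i\<in>{1..k}. perron_digit \<phi> i (x n) = c i) \<and>
        filterlim ?d at_top sequentially"
    then obtain n0 where n0: "n0 \<ge> 1" "\<And>n. n \<ge> n0 \<Longrightarrow> x n \<in> ?cyl"
        and d: "filterlim ?d at_top sequentially"
      using cyl_iff by (meson order_trans)
    have "filterlim (\<lambda>n. real (?d n)) at_top sequentially"
      by (rule filterlim_compose[OF filterlim_real_sequentially d])
    then have "filterlim (\<lambda>n. - 1 + real (?d n)) at_top sequentially"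
      by (rule filterlim_tendsto_add_at_top[OF tendsto_const])
    then have upper: "(\<lambda>n. r / (- 1 + real (?d n))) \<longlonglongrightarrow> 0"
      by (intro real_tendsto_divide_at_top[OF tendsto_const])
    have "y \<longlonglongrightarrow> 0"
    proof (rule tendsto_sandwich[OF _ _ tendsto_const upper])
      show "eventually (\<lambda>n. 0 \<le> y n) sequentially"
        using eventually_ge_at_top[of 1] by eventually_elim (simp add: y_pos less_imp_le)
      show "eventually (\<lambda>n. y n \<le> r / (- 1 + real (?d n))) sequentially"
        using eventually_ge_at_top[of n0]
      proof eventually_elim
        case (elim n)
        then show ?case using bounds(2)[OF n0(2)[OF elim]] by simp
      qed
    qed
    then show "x \<longlonglongrightarrow> x0" by (simp add: lim_iff)
  qed
qed

end
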